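(* Let $p_0\in\mathbb{N}$ with $p_0\ge 1$ be fixed. For each $\epsilon_0>0$, the class of compact metric spaces $$\mathcal{C}_{\epsilon_0}:=\{(\mathbb{Z}/p\mathbb{Z},\tilde d_p)\;:\;p\in\mathbb{N},\ p>p_0,\ \tfrac{1}{p-1}<\epsilon_0\}$$ contains a sequence $(\mathbb{Z}/p_n\mathbb{Z},\tilde d_{p_n})_{n\ge 1}$, with $p_1<p_2<p_3<\cdots$, that converges in the Gromov-Hausdorff topology of compact metric spaces.
   Context: For $p\in\mathbb{N}$, $p\ge 2$, each class $[n]_p\in\mathbb{Z}/p\mathbb{Z}$ has a unique representative $n_0\in[n]_p$ with $0\le n_0\le p-1$. Define $d_p([n]_p,[m]_p):=|n_0-m_0|$, a metric on $\mathbb{Z}/p\mathbb{Z}$ of diameter $p-1$, and the normalized metric $\tilde d_p:=\frac{1}{p-1}d_p$. Gromov-Hausdorff convergence is convergence with respect to the Gromov-Hausdorff distance between compact metric spaces (limits are compact metric spaces, unique up to isometry). *)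

theory Defs
  imports "HOL-Analysis.Analysis" "HOL-Algebra.IntRing"
begin

section \<open>Gromov-Hausdorff convergence of compact metric spaces\<close>

definition compact_metric_space :: "'a metric \<Rightarrow> bool" where
  "compact_metric_space X \<longleftrightarrow> mspace X \<noteq> {} \<and> compact_space (mtopology_of X)"

text \<open>Only meaningful for nonempty bounded sets \<open>A\<close> and \<open>B\<close>; otherwise the set of radii may be
  empty and its infimum in the reals is unspecified.\<close>

definition hausdorff_dist :: "'a metric \<Rightarrow> 'a set \<Rightarrow> 'a set \<Rightarrow> real" where
  "hausdorff_dist Z A B =
     Inf {r. 0 < r \<and> A \<subseteq> (\<Union>b\<in>B. mball_of Z b r) \<and> B \<subseteq> (\<Union>a\<in>A. mball_of Z a r)}"

definition isometric_embedding :: "'a metric \<Rightarrow> 'b metric \<Rightarrow> ('a \<Rightarrow> 'b) \<Rightarrow> bool" where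
  "isometric_embedding X Z f \<longleftrightarrow>
     f \<in> mspace X \<rightarrow> mspace Z \<and>
     (\<forall>x\<in>mspace X. \<forall>y\<in>mspace X. mdist Z (f x) (f y) = mdist X x y)"

text \<open>The infimum of the Hausdorff distances between isometric copies of \<open>X\<close> and \<open>Y\<close> in a common
  metric space \<open>Z\<close>.  One may shrink \<open>Z\<close> to the union of the two copies, which injects into
  the sum type; so carriers \<open>Z\<close> in the sum type account for all ambient spaces.\<close>

definition gromov_hausdorff_dist :: "'a metric \<Rightarrow> 'b metric \<Rightarrow> real" where
  "gromov_hausdorff_dist X Y =
     Inf {hausdorff_dist Z (f ` mspace X) (g ` mspace Y) | (Z :: ('a + 'b) metric) f g.
            isometric_embedding X Z f \<and> isometric_embedding Y Z g}"

text \<open>A compact metric space has at most the cardinality of the continuum, so every one is isometric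
  to a space whose carrier is a set of reals.  The metric on that carrier is arbitrary.\<close>

definition gromov_hausdorff_convergent :: "(nat \<Rightarrow> 'a metric) \<Rightarrow> bool" where
  "gromov_hausdorff_convergent X \<longleftrightarrow>
     (\<exists>L :: real metric. compact_metric_space L \<and>
        (\<lambda>n. gromov_hausdorff_dist (X n) L) \<longlonglongrightarrow> 0)"


section \<open>The normalized metrics on residue classes\<close>

definition zmod_rep :: "nat \<Rightarrow> int set \<Rightarrow> int" where
  "zmod_rep p c = (THE r. r \<in> c \<and> 0 \<le> r \<and> r \<le> int p - 1)"

definition zmod_dist :: "nat \<Rightarrow> int set \<Rightarrow> int set \<Rightarrow> real" where
  "zmod_dist p a b = of_int \<bar>zmod_rep p a - zmod_rep p b\<bar>"

definition zmod_ndist :: "nat \<Rightarrow> int set \<Rightarrow> int set \<Rightarrow> real" where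
  "zmod_ndist p a b = 1 / (real p - 1) * zmod_dist p a b"

definition zmod_space :: "nat \<Rightarrow> int set metric" where
  "zmod_space p = metric (carrier (ZFact (int p)), zmod_ndist p)"

definition zmod_class :: "nat \<Rightarrow> real \<Rightarrow> int set metric set" where
  "zmod_class p0 \<epsilon>0 = {zmod_space p | p. p > p0 \<and> 1 / (real p - 1) < \<epsilon>0}"


text \<open>\<open>zmod_space p\<close> is built with the abstraction function of the type \<open>metric\<close>; the following facts
  show that it does denote the intended space, and that this space is compact.\<close>

lemma mem_ZMod_iff: "x \<in> ZMod k r \<longleftrightarrow> x mod k = r mod k"
proof -
  interpret I: ideal "Idl\<^bsub>\<Z>\<^esub> {k}" "\<Z>"
    by (rule int.genideal_ideal) simp
  have self: "x \<in> ZMod k x"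
    unfolding ZMod_def by (rule I.a_rcos_self) simp
  have "ZMod k r = ZMod k x" if "x \<in> ZMod k r"
    using that unfolding ZMod_def by (rule I.a_repr_independence') simp
  with self show ?thesis by (metis ZMod_eq_mod)
qed

lemma carrier_ZFact: "carrier (ZFact k) = range (ZMod k)"
  by (auto simp: ZFact_defs A_RCOSETS_def' ZMod_def)

lemma zmod_rep_ZMod:
  assumes "p \<ge> 1"
  shows "zmod_rep p (ZMod (int p) n) = n mod int p"
  unfolding zmod_rep_def
proof (rule the_equality)
  show "n mod int p \<in> ZMod (int p) n \<and> 0 \<le> n mod int p \<and> n mod int p \<le> int p - 1"
    using assms by (simp add: mem_ZMod_iff)
next
  fix r assume "r \<in> ZMod (int p) n \<and> 0 \<le> r \<and> r \<le> int p - 1"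
  then show "r = n mod int p" by (auto simp: mem_ZMod_iff)
qed

lemma Metric_space_zmod:
  assumes "p \<ge> 2"
  shows "Metric_space (carrier (ZFact (int p))) (zmod_ndist p)"
proof
  show "0 \<le> zmod_ndist p x y" for x y
    using assms by (simp add: zmod_ndist_def zmod_dist_def)
  show "zmod_ndist p x y = zmod_ndist p y x" for x y
    by (simp add: zmod_ndist_def zmod_dist_def abs_minus_commute)
next
  fix x y assume "x \<in> carrier (ZFact (int p))" "y \<in> carrier (ZFact (int p))"
  then show "(zmod_ndist p x y = 0) = (x = y)"
    using assms
    by (auto simp: carrier_ZFact zmod_ndist_def zmod_dist_def zmod_rep_ZMod mem_ZMod_iff)
next
  fix x y z
  have "zmod_dist p x z \<le> zmod_dist p x y + zmod_dist p y z"
    by (simp add: zmod_dist_def)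
  then show "zmod_ndist p x z \<le> zmod_ndist p x y + zmod_ndist p y z"
    using assms
    by (simp add: zmod_ndist_def add_divide_distrib [symmetric] divide_right_mono)
qed

lemma mspace_zmod_space:
  "p \<ge> 2 \<Longrightarrow> mspace (zmod_space p) = carrier (ZFact (int p))"
  unfolding zmod_space_def by (rule Metric_space.mspace_metric[OF Metric_space_zmod])

lemma mdist_zmod_space: "p \<ge> 2 \<Longrightarrow> mdist (zmod_space p) = zmod_ndist p"
  unfolding zmod_space_def by (rule Metric_space.mdist_metric[OF Metric_space_zmod])

lemma finite_carrier_ZFact:
  assumes "p \<ge> 1"
  shows "finite (carrier (ZFact (int p)))"
proof (rule finite_subset)
  show "carrier (ZFact (int p)) \<subseteq> ZMod (int p) ` {0..<int p}"
  proof
    fix c assume "c \<in> carrier (ZFact (int p))"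
    then obtain n where "c = ZMod (int p) n" by (auto simp: carrier_ZFact)
    then have "c = ZMod (int p) (n mod int p)" by (metis ZMod_mod)
    then show "c \<in> ZMod (int p) ` {0..<int p}"
      using assms by (intro image_eqI) auto
  qed
qed simp

lemma compact_zmod_space:
  assumes "p \<ge> 2"
  shows "compact_metric_space (zmod_space p)"
  unfolding compact_metric_space_def
proof
  show "mspace (zmod_space p) \<noteq> {}"
    using assms by (simp add: mspace_zmod_space carrier_ZFact)
  show "compact_space (mtopology_of (zmod_space p))"
    using assms finite_carrier_ZFact[of p]
    by (simp add: compact_space_def finite_imp_compactin mspace_zmod_space)
qed

lemma zmod_class_compact:
  "p0 \<ge> 1 \<Longrightarrow> X \<in> zmod_class p0 \<epsilon>0 \<Longrightarrow> compact_metric_space X"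
  by (auto simp: zmod_class_def intro!: compact_zmod_space)

end

(* The map [k] \<mapsto> k / (p - 1) embeds the normalized space isometrically into [0,1] with image a
   1/(p - 1)-net, so the spaces converge to [0,1] along all p. *)
theory Submission
  imports Defs "HOL-Real_Asymp.Real_Asymp"
begin

text \<open>The limit is [0,1]. Scaling representatives by 1/(p-1) sends the residue classes to
  equally spaced points of [0,1] and preserves distances (\<open>zmod_ndist_ZMod\<close>), and
  rounding down shows that every t in [0,1] is close to one of these points. A space embedded as an
  r-net in another lies at Gromov-Hausdorff distance at most r from it
  (\<open>gromov_hausdorff_dist_net\<close>). Hence the distance to [0,1] is at most 2/(p-1)
  (\<open>gromov_hausdorff_dist_zmod\<close>), and any increasing sequence of moduli, started late
  enough to meet both constraints, will do. Since both distances are infima of reals, each estimate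
  also needs the sets involved to be nonempty or bounded below; the diameter bounds \<open>D\<close>
  provide this.\<close>

lemma hausdorff_dist_le:
  assumes "0 < r" "A \<subseteq> (\<Union>b\<in>B. mball_of Z b r)" "B \<subseteq> (\<Union>a\<in>A. mball_of Z a r)"
  shows "hausdorff_dist Z A B \<le> r"
  unfolding hausdorff_dist_def
  by (rule cInf_lower) (use assms in \<open>auto intro!: bdd_belowI[of _ 0]\<close>)

text \<open>All radii are positive, so the point is that some radius is admissible: the infimum of
  the empty set is unspecified.\<close>

lemma hausdorff_dist_nonneg:
  assumes A: "A \<subseteq> mspace Z" "A \<noteq> {}" "\<And>x y. x \<in> A \<Longrightarrow> y \<in> A \<Longrightarrow> mdist Z x y \<le> D"
    and B: "B \<subseteq> mspace Z" "B \<noteq> {}" "\<And>x y. x \<in> B \<Longrightarrow> y \<in> B \<Longrightarrow> mdist Z x y \<le> D"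
  shows "0 \<le> hausdorff_dist Z A B"
proof -
  obtain a b where ab: "a \<in> A" "b \<in> B" using A B by blast
  \<comment> \<open>Through \<open>a\<close>, each point of \<open>A\<close> is within
    \<open>D + mdist Z a b\<close> of \<open>b\<close>; symmetrically for \<open>B\<close> and
    \<open>a\<close>. The extra 1 makes the inequality strict, as open balls require.\<close>
  define r where "r = D + mdist Z a b + 1"
  have "0 \<le> D"
    using A(3)[OF ab(1) ab(1)] mdist_nonneg[of Z a a] by linarith
  then have "0 < r"
    using mdist_nonneg[of Z a b] unfolding r_def by linarith
  have "x \<in> mball_of Z b r" if "x \<in> A" for x
  proof -
    have "x \<in> mspace Z" "a \<in> mspace Z" "b \<in> mspace Z" using that ab A B by auto
    moreover from this have "mdist Z x b \<le> mdist Z x a + mdist Z a b" by (rule mdist_triangle)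
    then have "mdist Z x b < r"
      using A(3)[OF that ab(1)] unfolding r_def by linarith
    ultimately show ?thesis by (simp add: mdist_commute)
  qed
  moreover have "x \<in> mball_of Z a r" if "x \<in> B" for x
  proof -
    have "a \<in> mspace Z" "b \<in> mspace Z" "x \<in> mspace Z" using that ab A B by auto
    moreover from this have "mdist Z a x \<le> mdist Z a b + mdist Z b x" by (rule mdist_triangle)
    then have "mdist Z a x < r"
      using B(3)[OF ab(2) that] unfolding r_def by linarith
    ultimately show ?thesis by simp
  qed
  ultimately have "A \<subseteq> (\<Union>b\<in>B. mball_of Z b r)" "B \<subseteq> (\<Union>a\<in>A. mball_of Z a r)"
    using ab by blast+
  with \<open>0 < r\<close> show ?thesis
    unfolding hausdorff_dist_def by (intro cInf_greatest) auto
qed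

context
  fixes X :: "'a metric" and Y :: "'b metric" and D :: real
  assumes X: "mspace X \<noteq> {}" "\<And>x y. x \<in> mspace X \<Longrightarrow> y \<in> mspace X \<Longrightarrow> mdist X x y \<le> D"
    and Y: "mspace Y \<noteq> {}" "\<And>x y. x \<in> mspace Y \<Longrightarrow> y \<in> mspace Y \<Longrightarrow> mdist Y x y \<le> D"
begin

text \<open>Embeddings carry the bound \<open>D\<close> over to the images, so 0 is a lower bound
  over all \<open>Z\<close> at once; this makes \<open>cInf_lower2\<close> applicable to the
  Gromov-Hausdorff infimum.\<close>

lemma hausdorff_dist_isometric_nonneg:
  assumes "isometric_embedding X Z f" "isometric_embedding Y Z g"
  shows "0 \<le> hausdorff_dist Z (f ` mspace X) (g ` mspace Y)"
  by (rule hausdorff_dist_nonneg[where D = D])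
     (use assms X Y in \<open>auto simp: isometric_embedding_def\<close>)

lemma gromov_hausdorff_dist_le:
  fixes Z :: "('a + 'b) metric"
  assumes "isometric_embedding X Z f" "isometric_embedding Y Z g"
    and "hausdorff_dist Z (f ` mspace X) (g ` mspace Y) \<le> r"
  shows "gromov_hausdorff_dist X Y \<le> r"
  unfolding gromov_hausdorff_dist_def
  by (rule cInf_lower2[OF _ assms(3)])
     (use assms hausdorff_dist_isometric_nonneg in \<open>auto intro!: bdd_belowI[of _ 0]\<close>)

text \<open>The given pair of embeddings serves as a witness that the infimum is over a nonempty
  set.\<close>

lemma gromov_hausdorff_dist_nonneg:
  fixes Z :: "('a + 'b) metric"
  assumes "isometric_embedding X Z f" "isometric_embedding Y Z g"
  shows "0 \<le> gromov_hausdorff_dist X Y"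
  unfolding gromov_hausdorff_dist_def
  by (rule cInf_greatest) (use assms hausdorff_dist_isometric_nonneg in auto)

text \<open>If \<open>X\<close> embeds in \<open>Y\<close>, then the right summand alone is a suitable ambient space.\<close>

lemma gromov_hausdorff_dist_net:
  assumes h: "isometric_embedding X Y h" and "0 < r"
    and net: "\<And>y. y \<in> mspace Y \<Longrightarrow> \<exists>x\<in>mspace X. mdist Y (h x) y < r"
  shows "0 \<le> gromov_hausdorff_dist X Y" "gromov_hausdorff_dist X Y \<le> r"
proof -
  \<comment> \<open>The value of \<open>projr\<close> on left elements is unspecified, but the
    carrier of \<open>Z\<close> contains only right ones.\<close>
  define d where "d = (\<lambda>(a :: 'a + 'b) (b :: 'a + 'b). mdist Y (projr a) (projr b))"
  define Z where "Z = metric (Inr ` mspace Y :: ('a + 'b) set, d)"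
  interpret Z: Metric_space "Inr ` mspace Y :: ('a + 'b) set" d
    by unfold_locales (auto simp: d_def mdist_commute mdist_triangle)
  have Z: "mspace Z = Inr ` mspace Y" "mdist Z = d"
    unfolding Z_def by simp_all
  have f: "isometric_embedding X Z (Inr \<circ> h)" and g: "isometric_embedding Y Z Inr"
    using h by (auto simp: isometric_embedding_def Z d_def)
  have hY: "h x \<in> mspace Y" if "x \<in> mspace X" for x
    using h that by (auto simp: isometric_embedding_def)
  have "hausdorff_dist Z ((Inr \<circ> h) ` mspace X) (Inr ` mspace Y) \<le> r"
  proof (rule hausdorff_dist_le[OF \<open>0 < r\<close>])
    show "(Inr \<circ> h) ` mspace X \<subseteq> (\<Union>b\<in>Inr ` mspace Y. mball_of Z b r)"
    proof (rule image_subsetI)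
      fix x assume "x \<in> mspace X"
      then have "(Inr \<circ> h) x \<in> mball_of Z (Inr (h x)) r"
        using hY[OF \<open>x \<in> mspace X\<close>] \<open>0 < r\<close> mdist_zero[of "h x" Y "h x"]
        by (simp add: Z d_def del: mdist_zero)
      then show "(Inr \<circ> h) x \<in> (\<Union>b\<in>Inr ` mspace Y. mball_of Z b r)"
        using hY[OF \<open>x \<in> mspace X\<close>] by blast
    qed
    show "Inr ` mspace Y \<subseteq> (\<Union>a\<in>(Inr \<circ> h) ` mspace X. mball_of Z a r)"
    proof (rule image_subsetI)
      fix y assume "y \<in> mspace Y"
      with net obtain x where "x \<in> mspace X" "mdist Y (h x) y < r" by blast
      with hY \<open>y \<in> mspace Y\<close> have "Inr y \<in> mball_of Z ((Inr \<circ> h) x) r"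
        by (simp add: Z d_def)
      with \<open>x \<in> mspace X\<close> show "Inr y \<in> (\<Union>a\<in>(Inr \<circ> h) ` mspace X. mball_of Z a r)"
        by blast
    qed
  qed
  with f g show "gromov_hausdorff_dist X Y \<le> r" by (rule gromov_hausdorff_dist_le)
  show "0 \<le> gromov_hausdorff_dist X Y" using f g by (rule gromov_hausdorff_dist_nonneg)
qed

end

definition unit_interval :: "real metric" where
  "unit_interval = submetric euclidean_metric {0..1}"

lemma mspace_unit_interval [simp]: "mspace unit_interval = {0..1}"
  by (simp add: unit_interval_def)

lemma mdist_unit_interval [simp]: "mdist unit_interval = dist"
  by (simp add: unit_interval_def)

lemma compact_unit_interval: "compact_metric_space unit_interval"
  by (simp add: compact_metric_space_def unit_interval_def mtopology_of_submetric
      mtopology_of_euclidean compact_space_subtopology)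

lemma zmod_ndist_ZMod:
  assumes "p \<ge> 2"
  shows "zmod_ndist p (ZMod (int p) m) (ZMod (int p) n) =
    dist (of_int (m mod int p) / (real p - 1)) (of_int (n mod int p) / (real p - 1))"
proof -
  have "dist (x / (real p - 1)) (y / (real p - 1)) = 1 / (real p - 1) * \<bar>x - y\<bar>" for x y :: real
    using assms by (simp add: dist_real_def diff_divide_distrib[symmetric] abs_divide)
  then show ?thesis
    using assms by (simp add: zmod_ndist_def zmod_dist_def zmod_rep_ZMod)
qed

lemma scaled_residue_mem:
  assumes "p \<ge> 2"
  shows "real_of_int (n mod int p) / (real p - 1) \<in> {0..1}"
proof -
  have "0 \<le> n mod int p" "n mod int p \<le> int p - 1"
    using assms by auto
  then have "0 \<le> real_of_int (n mod int p)" "real_of_int (n mod int p) \<le> real p - 1"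
    by linarith+
  then show ?thesis using assms by (simp add: divide_le_eq)
qed

lemma gromov_hausdorff_dist_zmod:
  assumes "p \<ge> 2"
  shows "0 \<le> gromov_hausdorff_dist (zmod_space p) unit_interval"
    and "gromov_hausdorff_dist (zmod_space p) unit_interval \<le> 2 / (real p - 1)"
proof -
  let ?q = "real p - 1"
  define h where "h = (\<lambda>c. of_int (zmod_rep p c) / ?q)"
  have h: "h (ZMod (int p) n) = of_int (n mod int p) / ?q" for n
    using assms by (simp add: h_def zmod_rep_ZMod)
  have S: "mspace (zmod_space p) = range (ZMod (int p))" "mdist (zmod_space p) = zmod_ndist p"
    using assms by (simp_all add: mspace_zmod_space mdist_zmod_space carrier_ZFact)
  have unit_diam: "dist x y \<le> 1" if "x \<in> {0..1}" "y \<in> {0..1}" for x y :: real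
    using that by (auto simp: dist_real_def)
  have emb: "isometric_embedding (zmod_space p) unit_interval h"
    unfolding isometric_embedding_def S
    using scaled_residue_mem[OF assms] by (auto simp: h zmod_ndist_ZMod[OF assms])
  have diam: "mdist (zmod_space p) x y \<le> 1"
    if "x \<in> mspace (zmod_space p)" "y \<in> mspace (zmod_space p)" for x y
    using that unit_diam scaled_residue_mem[OF assms]
    by (auto simp: S zmod_ndist_ZMod[OF assms])
  have net: "\<exists>x\<in>mspace (zmod_space p). mdist unit_interval (h x) t < 2 / ?q"
    if t: "t \<in> mspace unit_interval" for t
  proof -
    have q: "?q > 0" using assms by simp
    define k where "k = \<lfloor>t * ?q\<rfloor>"
    have "0 \<le> t * ?q" "t * ?q \<le> ?q"
      using t q by (auto simp: mult_le_cancel_right1)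
    \<comment> \<open>As t \<le> 1, rounding down gives at most p - 1, so \<open>k\<close> is its
      own representative, even for t = 1.\<close>
    then have "0 \<le> k" "k < int p" unfolding k_def by linarith+
    then have "h (ZMod (int p) k) = of_int k / ?q" by (simp add: h)
    moreover have "t = t * ?q / ?q" using q by simp
    ultimately have "dist (h (ZMod (int p) k)) t = \<bar>of_int k - t * ?q\<bar> / ?q"
      using q by (metis abs_divide abs_of_pos diff_divide_distrib dist_real_def)
    \<comment> \<open>The rounding error of the floor is below 1.\<close>
    also have "\<dots> < 2 / ?q"
      by (rule divide_strict_right_mono[OF _ q]) (unfold k_def, linarith)
    finally show ?thesis by (auto simp: S)
  qed
  have "0 < 2 / ?q" using assms by simp
  note * = gromov_hausdorff_dist_net[where D = 1, OF _ diam _ _ emb this net]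
  show "0 \<le> gromov_hausdorff_dist (zmod_space p) unit_interval"
    and "gromov_hausdorff_dist (zmod_space p) unit_interval \<le> 2 / ?q"
    by (rule *; use unit_diam in \<open>auto simp: S\<close>)+
qed

theorem theorem3p4:
  fixes p0 :: nat and \<epsilon>0 :: real
  assumes "p0 \<ge> 1" and "\<epsilon>0 > 0"
  shows "\<exists>p :: nat \<Rightarrow> nat.
           strict_mono_on {1..} p \<and>
           (\<forall>n\<ge>1. p n > p0 \<and> 1 / (real (p n) - 1) < \<epsilon>0 \<and> zmod_space (p n) \<in> zmod_class p0 \<epsilon>0) \<and>
           gromov_hausdorff_convergent (\<lambda>n. zmod_space (p n))"
proof -
  obtain M :: nat where M: "1 / \<epsilon>0 < real M" using reals_Archimedean2 by blast
  \<comment> \<open>Here p n - 1 \<ge> M > 1/\<epsilon>0 gives the bound on the spacing, and the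
    summand \<open>p0 + 1\<close> gives p n > p0 and p n \<ge> 2.\<close>
  define p where "p n = p0 + M + 1 + n" for n
  have p: "p n > p0" "p n \<ge> 2" for n using assms by (auto simp: p_def)
  have small: "1 / (real (p n) - 1) < \<epsilon>0" for n
  proof -
    have "1 / \<epsilon>0 < real (p n) - 1" using M by (simp add: p_def)
    then show ?thesis using assms(2) p(2)[of n] by (simp add: field_simps)
  qed
  have "(\<lambda>n. 2 / (real (p n) - 1)) \<longlonglongrightarrow> 0"
    unfolding p_def by real_asymp
  then have "(\<lambda>n. gromov_hausdorff_dist (zmod_space (p n)) unit_interval) \<longlonglongrightarrow> 0"
    by (rule tendsto_sandwich[rotated 3])
       (use gromov_hausdorff_dist_zmod[OF p(2)] in auto)
  then have "gromov_hausdorff_convergent (\<lambda>n. zmod_space (p n))"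
    unfolding gromov_hausdorff_convergent_def using compact_unit_interval by blast
  moreover have "strict_mono_on {1..} p"
    by (auto simp: strict_mono_on_def p_def)
  ultimately show ?thesis
    using p small by (auto simp: zmod_class_def intro!: exI[of _ p])
qed

end
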